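(* The group of automorphisms of the field extension $\mathbb{R}(P,Q)\subset\mathbb{R}(x,y)$ (that is, of field automorphisms of $\mathbb{R}(x,y)$ fixing every element of $\mathbb{R}(P,Q)$) is trivial.
   Context: The polynomials $P,Q\in\mathbb{R}[x,y]$ are the components of the following specific Pinchuk map: put $t=xy-1$, $h=t(xt+1)$, $f=(xt+1)^2(t^2+y)$, $P=f+h$, and $Q=-t^2-6th(h+1)-u(f,h)$, where $u(f,h)=170fh+91h^2+195fh^2+69h^3+75fh^3+\tfrac{75}{4}h^4$. *)

theory Defs
  imports
    "HOL-Computational_Algebra.Computational_Algebra"
    "HOL-Algebra.Algebraic_Closure_Type"
    "HOL-Algebra.Generated_Fields"
    "HOL-Algebra.Bij"
    "HOL-Algebra.Elementary_Groups"
begin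

text \<open>
  The ring \<open>\<real>[x, y]\<close> is the type \<^typ>\<open>real poly poly\<close>: the inner variable is \<open>x\<close>,
  the outer one is \<open>y\<close>.  Its fraction field \<open>\<real>(x, y)\<close> is \<^typ>\<open>real poly poly fract\<close>.
\<close>

definition const_xy :: "real \<Rightarrow> real poly poly"
  where "const_xy c = [:[:c:]:]"

definition var_x :: "real poly poly"
  where "var_x = [:[:0, 1:]:]"

definition var_y :: "real poly poly"
  where "var_y = [:0, 1:]"

definition pinchuk_t :: "real poly poly"
  where "pinchuk_t = var_x * var_y - 1"

definition pinchuk_h :: "real poly poly"
  where "pinchuk_h = pinchuk_t * (var_x * pinchuk_t + 1)"

definition pinchuk_f :: "real poly poly"
  where "pinchuk_f = (var_x * pinchuk_t + 1)^2 * (pinchuk_t^2 + var_y)"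

definition pinchuk_u :: "real poly poly \<Rightarrow> real poly poly \<Rightarrow> real poly poly"
  where "pinchuk_u f h =
    170 * f * h + 91 * h^2 + 195 * f * h^2 + 69 * h^3 + 75 * f * h^3 + const_xy (75/4) * h^4"

definition pinchuk_P :: "real poly poly"
  where "pinchuk_P = pinchuk_f + pinchuk_h"

definition pinchuk_Q :: "real poly poly"
  where "pinchuk_Q =
    - (pinchuk_t^2) - 6 * pinchuk_t * pinchuk_h * (pinchuk_h + 1) - pinchuk_u pinchuk_f pinchuk_h"

abbreviation field_R_xy :: "real poly poly fract ring"
  where "field_R_xy \<equiv> ring_of_type_algebra"

definition adjoin_R :: "real poly poly set \<Rightarrow> real poly poly fract set"
  where "adjoin_R S = generate_field field_R_xy (to_fract ` (range const_xy \<union> S))"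

text \<open>
  The group of field automorphisms of \<open>L\<close> fixing \<open>K\<close> pointwise, built in the same way as
  \<^const>\<open>AutoGroup\<close>: \<^const>\<open>Bij\<close> restricts to maps that are extensional on the carrier.
\<close>

definition field_ext_aut_group :: "('a, 'b) ring_scheme \<Rightarrow> 'a set \<Rightarrow> ('a \<Rightarrow> 'a) monoid"
  where "field_ext_aut_group L K =
    BijGroup (carrier L)
      \<lparr>carrier := {\<sigma> \<in> ring_iso L L \<inter> Bij (carrier L). \<forall>a\<in>K. \<sigma> a = a}\<rparr>"

end

theory Submission
  imports Defs
begin

text \<open>
  Why there are no symmetries.  Write \<open>p = P\<close> and \<open>v = f\<close>.  Pinchuk's auxiliary polynomials satisfy
  \<open>f (h - t) = h\<^sup>2 (h + 1)\<close>, \<open>x t\<^sup>2 = h - t\<close> and \<open>y (h - t) = (t + 1) t\<^sup>2\<close>, while \<open>h = p - v\<close>.  Hence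
  \<open>t\<close>, \<open>x\<close> and \<open>y\<close> are rational functions of \<open>p\<close> and \<open>v\<close>: the field \<open>\<real>(x, y)\<close> is \<open>\<real>(p, v)\<close>
  with \<open>p\<close>, \<open>v\<close> algebraically independent (\<open>rational_in_P_f\<close>, \<open>eval_Pf_eq_0_iff\<close>).  In these
  coordinates \<open>Q = F / v\<^sup>2\<close>, where \<open>F\<close> is a polynomial of degree 6 in \<open>v\<close> over \<open>\<real>[p]\<close>.

  So \<open>Q\<close> is a Laurent polynomial in \<open>v\<close> over \<open>\<real>(p)\<close>, with a pole of order 2 at \<open>v = 0\<close> and
  a pole of order 4 at \<open>v = \<infinity>\<close>.  A field endomorphism \<open>\<sigma>\<close> that fixes \<open>\<real>(P, Q)\<close> is determined by the
  rational function \<open>g = \<sigma> v\<close>, which satisfies \<open>Q(g) = Q(v)\<close>.  Counting poles,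
  \<open>g\<close> is a Moebius transformation over \<open>\<real>(p)\<close>; as the two pole orders differ, it fixes both \<open>0\<close> and
  \<open>\<infinity>\<close>, so \<open>g = c v\<close>; and comparing the two leading coefficients of \<open>F\<close>, both nonzero, forces \<open>c = 1\<close>.  This step is carried out
  in \<open>rational_symmetry\<close> for arbitrary Laurent polynomials of this shape, with divisibility in
  the factorial ring \<open>\<real>[p][v]\<close> in place of poles.  Since \<open>\<sigma>\<close> then fixes both \<open>p\<close> and \<open>v\<close>,
  it is the identity.
\<close>

section \<open>Rational symmetries of a Laurent polynomial\<close>

text \<open>This is \<open>B\<^sup>n F(A / B)\<close> for \<open>n\<close> the degree of \<open>F\<close>, written without denominators.\<close>

definition homogenization :: "'a::comm_ring_1 poly \<Rightarrow> 'a poly \<Rightarrow> 'a poly \<Rightarrow> 'a poly" where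
  "homogenization F A B =
     (\<Sum>k\<le>degree F. smult (coeff F k) (A ^ k * B ^ (degree F - k)))"

lemma pcompose_monom: "pcompose (monom c k) A = smult c (A ^ k)"
  by (induction k) (simp_all add: monom_0 monom_Suc pcompose_pCons)

lemma dvd_homogenization_minus_lead:
  "B dvd homogenization F A B - smult (lead_coeff F) (A ^ degree F)"
proof -
  have "homogenization F A B = (\<Sum>k<degree F. smult (coeff F k) (A ^ k * B ^ (degree F - k)))
      + smult (lead_coeff F) (A ^ degree F)"
    unfolding homogenization_def by (simp flip: lessThan_Suc_atMost)
  moreover have "B dvd (\<Sum>k<degree F. smult (coeff F k) (A ^ k * B ^ (degree F - k)))"
    by (intro dvd_sum dvd_smult dvd_mult dvd_power) auto
  ultimately show ?thesis by simp
qed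

text \<open>
  Modulo a common divisor of \<open>B\<close> and the homogenization only the leading term of \<open>F\<close> is left, and
  that is a unit times a power of \<open>A\<close>.
\<close>

lemma coprime_homogenization:
  fixes F A B :: "'a::{factorial_ring_gcd,semiring_gcd_mult_normalize} poly"
  assumes "coprime A B" and "is_unit (lead_coeff F)"
  shows "coprime B (homogenization F A B)"
proof (rule coprimeI)
  fix d assume d: "d dvd B" "d dvd homogenization F A B"
  from d have "d dvd smult (lead_coeff F) (A ^ degree F)"
    using dvd_homogenization_minus_lead[of B F A] by (meson dvd_diffD dvd_trans dvd_diff_right_iff
      dvd_diff_left_iff)
  moreover have "smult (lead_coeff F) (A ^ degree F) dvd A ^ degree F"
  proof -
    obtain c where c: "1 = lead_coeff F * c" using assms(2) by (rule dvdE)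
    have "A ^ degree F = smult (lead_coeff F) (A ^ degree F) * [:c:]" using c[symmetric] by (simp add: mult.commute)
    then show ?thesis by (rule dvdI)
  qed
  ultimately have "d dvd A ^ degree F" by (rule dvd_trans)
  moreover have "coprime (A ^ degree F) d"
    using coprime_divisors[of "A ^ degree F" "A ^ degree F" d B] assms(1) d(1) by simp
  ultimately show "is_unit d" by (metis coprime_absorb_right)
qed

text \<open>
  Let \<open>n\<close> be the degree of \<open>F\<close>.  The equation says that \<open>\<phi>(A / B) = \<phi>(v)\<close> for \<open>\<phi> = F / v\<^sup>m\<close>, whose
  poles at \<open>0\<close> and \<open>\<infinity>\<close> have the orders \<open>m\<close> and \<open>n - m > m\<close>.  Since \<open>B\<close> is coprime to the
  homogenization, \<open>B\<close> to the power \<open>n - m\<close> divides \<open>v\<^sup>m\<close>, so \<open>B\<close> is constant for degree reasons: poles of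
  \<open>A / B\<close> would give poles of \<open>\<phi>(v)\<close> at finite places of too large an order.  Then degrees
  show that \<open>A\<close> is linear, and the value at \<open>v = 0\<close> that its constant term vanishes.  For \<open>A = a v\<close> and
  \<open>B = b\<close> the coefficients of \<open>F\<close> at \<open>n\<close> and \<open>n - 1\<close> give \<open>a\<^sup>n = a\<^sup>m b\<^bsup>n-m\<^esup>\<close> and \<open>a\<^bsup>n-1\<^esup> b = a\<^sup>m b\<^bsup>n-m\<^esup>\<close>,
  so \<open>a = b\<close>.
\<close>

lemma rational_symmetry:
  fixes F A B :: "'a::{factorial_ring_gcd,semiring_gcd_mult_normalize} poly"
  assumes cop: "coprime A B" and "B \<noteq> 0"
    and m: "0 < m" "2 * m < degree F"
    and unit: "is_unit (lead_coeff F)"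
    and const: "coeff F 0 \<noteq> 0" and next_coeff: "coeff F (degree F - 1) \<noteq> 0"
    and eq: "homogenization F A B * monom 1 m = F * A ^ m * B ^ (degree F - m)"
  shows "A = B * monom 1 1"
proof -
  define n where "n = degree F"
  have mn: "m < n" "m < n - m" using m unfolding n_def by auto
  have "B ^ (n - m) dvd homogenization F A B * monom 1 m"
    unfolding eq n_def by simp
  moreover have "coprime (B ^ (n - m)) (homogenization F A B)"
    using coprime_homogenization[OF cop unit] by simp
  ultimately have "B ^ (n - m) dvd monom 1 m"
    by (simp add: coprime_dvd_mult_right_iff)
  then have "degree (B ^ (n - m)) \<le> m"
    by (metis degree_monom_eq dvd_imp_degree_le monom_eq_0_iff one_neq_zero)
  then have "(n - m) * degree B \<le> m"
    using \<open>B \<noteq> 0\<close> by (simp add: degree_power_eq)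
  then have "degree B = 0"
    using mn by (metis leD le_trans mult.right_neutral mult_le_mono2 neq0_conv less_eq_Suc_le One_nat_def)
  then obtain b where B: "B = [:b:]" by (metis degree_eq_zeroE)
  have b: "b \<noteq> 0" using \<open>B \<noteq> 0\<close> B by simp
  have bpow: "B ^ k = [:b ^ k:]" for k unfolding B by (simp add: poly_const_pow)
  have hom: "homogenization F A B = (\<Sum>k\<le>n. smult (coeff F k * b ^ (n - k)) (A ^ k))"
    unfolding homogenization_def bpow n_def by (simp add: mult.commute)
  also have "\<dots> = (\<Sum>k\<le>n. pcompose (monom (coeff F k * b ^ (n - k)) k) A)"
    by (simp add: pcompose_monom)
  also have "\<dots> = pcompose (\<Sum>k\<le>n. monom (coeff F k * b ^ (n - k)) k) A"
    by (simp add: pcompose_sum)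
  finally have hom': "homogenization F A B = pcompose (\<Sum>k\<le>n. monom (coeff F k * b ^ (n - k)) k) A"
    (is "_ = pcompose ?G A") .
  \<comment> \<open>With \<open>B\<close> constant the homogenization is an honest composition, and its degree is known.\<close>
  have coeffG: "coeff ?G k = (if k \<le> n then coeff F k * b ^ (n - k) else 0)" for k
    by (simp add: coeff_sum)
  have F0: "F \<noteq> 0" using const by auto
  have degG: "degree ?G = n"
  proof (rule antisym)
    show "degree ?G \<le> n" by (rule degree_le) (simp add: coeffG)
    show "n \<le> degree ?G" using F0 coeffG[of n] by (intro le_degree) (simp add: n_def)
  qed
  have A0: "A \<noteq> 0"
  proof
    assume "A = 0"
    then have "homogenization F A B = [:coeff F 0 * b ^ n:]"
      unfolding hom' by (simp add: pcompose_0' coeffG)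
    then show False using eq m b const \<open>A = 0\<close> by (simp add: zero_power monom_eq_0_iff)
  qed
  have H0: "homogenization F A B \<noteq> 0"
    using eq F0 A0 \<open>B \<noteq> 0\<close> by auto
  have "degree (homogenization F A B * monom 1 m) = n * degree A + m"
    using H0 degG by (simp add: degree_mult_eq degree_monom_eq hom' degree_pcompose monom_eq_0_iff)
  moreover have "degree (F * A ^ m * B ^ (n - m)) = n + m * degree A"
    using F0 A0 \<open>B \<noteq> 0\<close> \<open>degree B = 0\<close>
    by (simp add: degree_mult_eq degree_power_eq n_def)
  ultimately have "n * degree A + m = n + m * degree A" using eq n_def by simp
  then have "int n * int (degree A) + int m = int n + int m * int (degree A)"
    by (metis of_nat_add of_nat_mult)
  then have "(int n - int m) * (int (degree A) - 1) = 0" by (simp add: algebra_simps)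
  then have degA: "degree A = 1" using mn by simp
  have "coeff (homogenization F A B * monom 1 m) 0 = 0"
    using m by (simp add: coeff_mult_0 coeff_monom)
  then have "coeff A 0 = 0"
    unfolding eq using const b by (simp add: coeff_mult_0 coeff_0_power B)
  then obtain a where A: "A = monom a 1"
    using degA by (metis One_nat_def degree_eq_zeroE degree_pCons_eq_if coeff_pCons_0 monom_0 monom_Suc pCons_cases
       nat.inject zero_neq_one)
  have lhs: "homogenization F A B * monom 1 m
      = (\<Sum>k\<le>n. monom (coeff F k * b ^ (n - k) * a ^ k) k) * monom 1 m"
    by (simp only: hom) (simp add: A monom_power smult_monom)
  have rhs: "F * A ^ m * B ^ (n - m) = smult (a ^ m * b ^ (n - m)) F * monom 1 m"
  proof -
    have "monom (a ^ m) m = smult (a ^ m) (monom 1 m)" by (simp add: smult_monom)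
    then show ?thesis unfolding A bpow by (simp add: monom_power mult.commute)
  qed
  have "(\<Sum>k\<le>n. monom (coeff F k * b ^ (n - k) * a ^ k) k) * monom 1 m =
      smult (a ^ m * b ^ (n - m)) F * monom 1 m"
    using eq[folded n_def, unfolded rhs] by (simp only: lhs)
  then have F: "(\<Sum>k\<le>n. monom (coeff F k * b ^ (n - k) * a ^ k) k) = smult (a ^ m * b ^ (n - m)) F"
    by (rule mult_right_cancel[THEN iffD1, rotated]) (simp add: monom_eq_0_iff)
  have cmp: "coeff F k * b ^ (n - k) * a ^ k = a ^ m * b ^ (n - m) * coeff F k" if "k \<le> n" for k
    using arg_cong[OF F, of "\<lambda>p. coeff p k"] that by (simp add: coeff_sum)
  have top: "a ^ n = a ^ m * b ^ (n - m)"
    using cmp[of n] F0 by (simp add: n_def)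
  have sub: "b * a ^ (n - 1) = a ^ m * b ^ (n - m)"
    using cmp[of "n - 1"] next_coeff mn by (simp add: n_def)
  have "a \<noteq> 0" using A A0 by auto
  have "a * a ^ (n - 1) = b * a ^ (n - 1)"
    using top sub mn by (metis less_nat_zero_code neq0_conv power_eq_if)
  then have "a = b" using \<open>a \<noteq> 0\<close> by simp
  then show ?thesis unfolding A B by (simp add: smult_monom)
qed

section \<open>Ring homomorphisms and evaluation\<close>

definition ring_map :: "('a::comm_ring_1 \<Rightarrow> 'b::comm_ring_1) \<Rightarrow> bool" where
  "ring_map \<phi> \<longleftrightarrow> \<phi> 1 = 1 \<and> (\<forall>a b. \<phi> (a + b) = \<phi> a + \<phi> b) \<and> (\<forall>a b. \<phi> (a * b) = \<phi> a * \<phi> b)"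

lemma ring_mapI:
  assumes "\<phi> 1 = 1" "\<And>a b. \<phi> (a + b) = \<phi> a + \<phi> b" "\<And>a b. \<phi> (a * b) = \<phi> a * \<phi> b"
  shows "ring_map \<phi>"
  using assms by (simp add: ring_map_def)

lemma
  assumes "ring_map \<phi>"
  shows ring_map_one: "\<phi> 1 = 1"
    and ring_map_add: "\<phi> (a + b) = \<phi> a + \<phi> b"
    and ring_map_mult: "\<phi> (a * b) = \<phi> a * \<phi> b"
  using assms by (simp_all add: ring_map_def)

lemma ring_map_zero: assumes "ring_map \<phi>" shows "\<phi> 0 = 0"
  using ring_map_add[OF assms, of 0 0] by simp

lemma ring_map_minus: assumes "ring_map \<phi>" shows "\<phi> (- a) = - \<phi> a"
  using ring_map_add[OF assms, of "- a" a] ring_map_zero[OF assms] by (simp add: eq_neg_iff_add_eq_0)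

lemma ring_map_diff: assumes "ring_map \<phi>" shows "\<phi> (a - b) = \<phi> a - \<phi> b"
  using ring_map_add[OF assms, of a "- b"] ring_map_minus[OF assms, of b] by simp

lemma ring_map_power: assumes "ring_map \<phi>" shows "\<phi> (a ^ k) = \<phi> a ^ k"
  by (induction k) (simp_all add: ring_map_one[OF assms] ring_map_mult[OF assms])

lemma ring_map_sum: assumes "ring_map \<phi>" shows "\<phi> (sum g S) = (\<Sum>s\<in>S. \<phi> (g s))"
  by (induction S rule: infinite_finite_induct) (simp_all add: ring_map_zero[OF assms] ring_map_add[OF assms])

lemma ring_map_numeral: assumes "ring_map \<phi>" shows "\<phi> (numeral n) = numeral n"
proof -
  have "\<phi> (of_nat k) = of_nat k" for k
    by (induction k) (simp_all add: ring_map_zero[OF assms] ring_map_one[OF assms] ring_map_add[OF assms])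
  from this[of "numeral n"] show ?thesis by simp
qed

lemmas ring_map_simps =
  ring_map_one ring_map_add ring_map_mult ring_map_zero ring_map_minus ring_map_diff
  ring_map_power ring_map_sum ring_map_numeral

lemma ring_map_compose:
  "ring_map \<phi> \<Longrightarrow> ring_map \<psi> \<Longrightarrow> ring_map (\<lambda>a. \<psi> (\<phi> a))"
  by (simp add: ring_map_def)

lemma ring_map_to_fract: "ring_map to_fract"
  by (rule ring_mapI) simp_all

lemma ring_map_const_xy: "ring_map const_xy"
  by (rule ring_mapI) (simp_all add: const_xy_def one_pCons)

lemma poly_map_poly_eq_sum:
  assumes "ring_map \<phi>"
  shows "poly (map_poly \<phi> p) a = (\<Sum>k\<le>degree p. \<phi> (coeff p k) * a ^ k)"
proof -
  have "degree (map_poly \<phi> p) \<le> degree p" by (rule map_poly_degree_leq)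
  then have "poly (map_poly \<phi> p) a = (\<Sum>k\<le>degree p. coeff (map_poly \<phi> p) k * a ^ k)"
    unfolding poly_altdef by (intro sum.mono_neutral_left) (auto simp: coeff_eq_0)
  then show ?thesis by (simp add: coeff_map_poly ring_map_zero[OF assms])
qed

lemma ring_map_poly:
  assumes "ring_map \<phi>"
  shows "ring_map (\<lambda>p. poly (map_poly \<phi> p) a)"
proof -
  note [simp] = ring_map_simps[OF assms]
  have "map_poly \<phi> (p + q) = map_poly \<phi> p + map_poly \<phi> q" for p q
    by (rule poly_eqI) (simp add: coeff_map_poly)
  moreover have "map_poly \<phi> (p * q) = map_poly \<phi> p * map_poly \<phi> q" for p q
    by (rule poly_eqI) (simp add: coeff_map_poly coeff_mult)
  ultimately show ?thesis by (intro ring_mapI) simp_all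
qed

text \<open>
  The value of a polynomial at a pair \<open>(a, b)\<close>: the inner variable becomes \<open>a\<close>, the outer one \<open>b\<close>,
  and \<open>\<iota>\<close> embeds the real coefficients into the target ring.
\<close>

definition eval_xy ::
  "(real \<Rightarrow> 'a::comm_ring_1) \<Rightarrow> 'a \<Rightarrow> 'a \<Rightarrow> real poly poly \<Rightarrow> 'a" where
  "eval_xy \<iota> a b G = poly (map_poly (\<lambda>c. poly (map_poly \<iota> c) a) G) b"

lemma ring_map_eval_xy: "ring_map \<iota> \<Longrightarrow> ring_map (eval_xy \<iota> a b)"
  unfolding eval_xy_def by (intro ring_map_poly)

lemma
  assumes "ring_map \<iota>"
  shows eval_xy_const: "eval_xy \<iota> a b (const_xy c) = \<iota> c"
    and eval_xy_var_x: "eval_xy \<iota> a b var_x = a"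
    and eval_xy_var_y: "eval_xy \<iota> a b var_y = b"
  by (simp_all add: eval_xy_def const_xy_def var_x_def var_y_def map_poly_pCons ring_map_simps[OF assms])

lemma real_poly_poly_induct [case_names const x y add mult]:
  assumes const: "\<And>c. Pr (const_xy c)" and x: "Pr var_x" and y: "Pr var_y"
    and add: "\<And>a b. Pr a \<Longrightarrow> Pr b \<Longrightarrow> Pr (a + b)"
    and mult: "\<And>a b. Pr a \<Longrightarrow> Pr b \<Longrightarrow> Pr (a * b)"
  shows "Pr G"
proof -
  have zero: "Pr 0" using const[of 0] by (simp add: const_xy_def)
  have inner: "Pr [:p:]" for p
  proof (induction p)
    case 0 then show ?case using zero by simp
  next
    case (pCons c p)
    have "[:pCons c p:] = const_xy c + var_x * [:p:]" by (simp add: const_xy_def var_x_def)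
    then show ?case using pCons.IH const x add mult by metis
  qed
  show ?thesis
  proof (induction G)
    case 0 then show ?case by (rule zero)
  next
    case (pCons p G)
    have "pCons p G = [:p:] + var_y * G" by (simp add: var_y_def)
    then show ?case using pCons.IH inner y add mult by metis
  qed
qed

lemma ring_map_eqI:
  assumes "ring_map \<phi>" "ring_map \<psi>"
    and "\<And>c. \<phi> (const_xy c) = \<psi> (const_xy c)" "\<phi> var_x = \<psi> var_x" "\<phi> var_y = \<psi> var_y"
  shows "\<phi> G = \<psi> G"
  by (induction G rule: real_poly_poly_induct) (simp_all add: assms ring_map_simps[OF assms(1)] ring_map_simps[OF assms(2)])

section \<open>The function field in the coordinates P and f\<close>

abbreviation real_fract :: "real \<Rightarrow> real poly poly fract" where
  "real_fract c \<equiv> to_fract (const_xy c)"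

lemma ring_map_real_fract: "ring_map real_fract"
  by (rule ring_map_compose[OF ring_map_const_xy ring_map_to_fract])

text \<open>
  These three equations can be solved one after the other for \<open>t\<close>, \<open>x\<close> and \<open>y\<close> once \<open>f\<close> and \<open>h\<close> are
  known; they are the source of the rational inverse of \<open>(x, y) \<mapsto> (P, f)\<close>.
\<close>

lemma pinchuk_relations:
  shows "pinchuk_f * (pinchuk_h - pinchuk_t) = pinchuk_h^2 * (pinchuk_h + 1)"
    and "var_x * pinchuk_t^2 = pinchuk_h - pinchuk_t"
    and "var_y * (pinchuk_h - pinchuk_t) = (pinchuk_t + 1) * pinchuk_t^2"
proof -
  have t: "var_x * var_y = pinchuk_t + 1" by (simp add: pinchuk_t_def)
  show 2: "var_x * pinchuk_t^2 = pinchuk_h - pinchuk_t"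
    by (simp add: pinchuk_h_def algebra_simps power2_eq_square)
  show 3: "var_y * (pinchuk_h - pinchuk_t) = (pinchuk_t + 1) * pinchuk_t^2"
    unfolding 2[symmetric] t[symmetric] by (simp add: algebra_simps)
  have "pinchuk_f * (pinchuk_h - pinchuk_t)
     = (var_x * pinchuk_t + 1)^2 * (pinchuk_t^2 * (pinchuk_h - pinchuk_t) + var_y * (pinchuk_h - pinchuk_t))"
    by (simp add: pinchuk_f_def algebra_simps)
  also have "\<dots> = (var_x * pinchuk_t + 1)^2 * (pinchuk_t^2 * (pinchuk_h + 1))"
    unfolding 3 by (simp add: algebra_simps)
  also have "\<dots> = pinchuk_h^2 * (pinchuk_h + 1)"
    by (simp add: pinchuk_h_def power_mult_distrib mult_ac)
  finally show "pinchuk_f * (pinchuk_h - pinchuk_t) = pinchuk_h^2 * (pinchuk_h + 1)" .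
qed

text \<open>
  Substitution of \<open>P\<close> and \<open>f\<close> for the two variables.  From here on \<open>real poly poly\<close> also plays the part of
  \<open>\<real>[p][v]\<close>, with \<open>var_x\<close> in the role of \<open>p\<close> and \<open>var_y\<close> in that of \<open>v\<close>.
\<close>

abbreviation eval_Pf :: "real poly poly \<Rightarrow> real poly poly fract" where
  "eval_Pf \<equiv> eval_xy real_fract (to_fract pinchuk_P) (to_fract pinchuk_f)"

lemmas eval_Pf_simps =
  ring_map_simps[OF ring_map_eval_xy[OF ring_map_real_fract], of "to_fract pinchuk_P" "to_fract pinchuk_f"]
  eval_xy_const[OF ring_map_real_fract]
  eval_xy_var_x[OF ring_map_real_fract] eval_xy_var_y[OF ring_map_real_fract]

lemma ring_map_eval_Pf: "ring_map eval_Pf"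
  by (rule ring_map_eval_xy[OF ring_map_real_fract])

text \<open>
  The polynomial \<open>F\<close> with \<open>Q = F(P, f) / f\<^sup>2\<close>.  Here \<open>w\<close> stands for \<open>f t\<close>, because
  \<open>f t = f h - h\<^sup>2 (h + 1)\<close>.
\<close>

definition pinchuk_numerator :: "real poly poly" where
  "pinchuk_numerator = (let h = var_x - var_y; w = var_y * h - h^2 * (h + 1) in
     - (w^2) - 6 * var_y * w * h * (h + 1) - var_y^2 * pinchuk_u var_y h)"

text \<open>
  What matters here is that the coefficient of \<open>v\<^sup>6\<close> is a unit and those of \<open>v\<^sup>5\<close> and \<open>1\<close> are nonzero.
\<close>

lemma pinchuk_numerator_expand:
  "pinchuk_numerator =
    [:[:0,0,0,0,-1,-2,-1:], [:0,0,0,12,24,12:], [:0,0,-128,-151,-255/4:],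
      [:0,54,134,80:], [:63,99,75/2:], [:-104,-114:], [:197/4:]:]"
  by (simp add: pinchuk_numerator_def Let_def pinchuk_u_def var_x_def var_y_def const_xy_def
     numeral_poly one_pCons power2_eq_square power3_eq_cube power4_eq_xxxx)

lemma eval_Pf_numerator:
  "eval_Pf pinchuk_numerator = to_fract pinchuk_Q * to_fract pinchuk_f^2"
proof -
  define h t f where "h = to_fract pinchuk_h" and "t = to_fract pinchuk_t" and "f = to_fract pinchuk_f"
  define h' where "h' = var_x - var_y"
  define w' where "w' = var_y * h' - h'^2 * (h' + 1)"
  define u where "u = to_fract (pinchuk_u pinchuk_f pinchuk_h)"
  note to_fract_simps = ring_map_simps[OF ring_map_to_fract]
  have f: "eval_Pf var_y = f" by (simp only: eval_Pf_simps f_def)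
  have h: "eval_Pf h' = h"
    by (simp only: h'_def eval_Pf_simps) (simp add: h_def pinchuk_P_def)
  have u: "eval_Pf (pinchuk_u var_y h') = u"
    unfolding pinchuk_u_def u_def by (simp only: eval_Pf_simps(1-9) f h eval_xy_const[OF ring_map_real_fract]
      to_fract_simps) (simp only: f_def h_def)
  have "f * (h - t) = h^2 * (h + 1)"
    using arg_cong[OF pinchuk_relations(1), of to_fract]
    by (simp only: f_def h_def t_def to_fract_simps)
  then have "f * h - h^2 * (h + 1) = f * t" by (simp add: algebra_simps)
  then have w: "eval_Pf w' = f * t"
    unfolding w'_def by (simp only: eval_Pf_simps(1-9) f h)
  have numerator: "pinchuk_numerator = - (w'^2) - 6 * var_y * w' * h' * (h' + 1) - var_y^2 * pinchuk_u var_y h'"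
    unfolding pinchuk_numerator_def Let_def w'_def h'_def ..
  have "eval_Pf pinchuk_numerator = - ((f * t)^2) - 6 * f * (f * t) * h * (h + 1) - f^2 * u"
    unfolding numerator by (simp only: eval_Pf_simps(1-9) f h w u)
  also have "\<dots> = (- (t^2) - 6 * t * h * (h + 1) - u) * f^2"
    by (simp add: algebra_simps power2_eq_square)
  also have "- (t^2) - 6 * t * h * (h + 1) - u = to_fract pinchuk_Q"
    by (simp only: pinchuk_Q_def h_def t_def u_def to_fract_simps)
  finally show ?thesis unfolding f_def .
qed

text \<open>
  The rational inverse: a homomorphism that sends \<open>x\<close> and \<open>y\<close> to the formulas obtained from
  \<open>pinchuk_relations\<close> sends \<open>P\<close> to \<open>p\<close> and \<open>f\<close> to \<open>v\<close>.
\<close>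

lemma pinchuk_inverse:
  fixes p v :: "'a::field"
  assumes \<phi>: "ring_map \<phi>"
    and h: "h = p - v" and t: "t = h - h^2 * (h + 1) / v"
    and x: "\<phi> var_x = (h - t) / t^2" and y: "\<phi> var_y = (t + 1) * t^2 / (h - t)"
    and nz: "v \<noteq> 0" "t \<noteq> 0" "h \<noteq> 0" "h + 1 \<noteq> 0"
  shows "\<phi> pinchuk_P = p" and "\<phi> pinchuk_f = v"
proof -
  note [simp] = ring_map_simps[OF \<phi>]
  have ht: "h - t = h^2 * (h + 1) / v" by (simp add: t)
  then have ht0: "h - t \<noteq> 0" using nz by simp
  have T: "\<phi> pinchuk_t = t"
    using ht0 nz by (simp add: pinchuk_t_def x y)
  have xt: "\<phi> var_x * t + 1 = h / t"
    using nz by (simp add: x field_simps power2_eq_square)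
  have H: "\<phi> pinchuk_h = h"
    using nz by (simp add: pinchuk_h_def T xt)
  have "\<phi> pinchuk_f * (h - t) = v * (h - t)"
    using arg_cong[OF pinchuk_relations(1), of \<phi>] nz by (simp add: T H ht)
  then show F: "\<phi> pinchuk_f = v" using ht0 by simp
  show "\<phi> pinchuk_P = p" by (simp add: pinchuk_P_def F H h)
qed

text \<open>
  Algebraic independence of \<open>P\<close> and \<open>f\<close>.  Applied to the generic point \<open>p = x\<close>, \<open>v = y\<close>, the rational
  inverse gives a homomorphism \<open>\<tau>\<close> with \<open>\<tau> (G(P, f)) = G(x, y)\<close>, so \<open>G\<close> can be recovered from \<open>G(P, f)\<close>.
\<close>

lemma eval_Pf_eq_0_iff: "eval_Pf G = 0 \<longleftrightarrow> G = 0"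
proof
  assume "eval_Pf G = 0"
  define x y where "x = to_fract var_x" and "y = to_fract var_y"
  define h where "h = x - y"
  define t where "t = h - h^2 * (h + 1) / y"
  define \<tau> where "\<tau> = eval_xy real_fract ((h - t) / t^2) ((t + 1) * t^2 / (h - t))"
  \<comment> \<open>\<open>\<tau>\<close> is defined on polynomials only, hence the detour through \<open>\<gamma>\<close>, the same substitution of
    \<open>P\<close> and \<open>f\<close> but with values in the polynomial ring.\<close>
  define \<gamma> where "\<gamma> = eval_xy const_xy pinchuk_P pinchuk_f"
  have \<tau>: "ring_map \<tau>" unfolding \<tau>_def by (rule ring_map_eval_xy[OF ring_map_real_fract])
  have \<gamma>: "ring_map \<gamma>" unfolding \<gamma>_def by (rule ring_map_eval_xy[OF ring_map_const_xy])
  have y: "y \<noteq> 0" by (simp add: y_def var_y_def)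
  have h: "h = to_fract (var_x - var_y)" by (simp add: h_def x_def y_def)
  have t: "t * y = to_fract ((var_x - var_y) * var_y - (var_x - var_y)^2 * (var_x - var_y + 1))"
    using y by (simp add: t_def h ring_map_simps[OF ring_map_to_fract] field_simps y_def)
  have "h \<noteq> 0" unfolding h by (simp add: var_x_def var_y_def)
  have "h + 1 = to_fract (var_x - var_y + 1)" by (simp add: h)
  also have "\<dots> \<noteq> 0" unfolding to_fract_eq_0_iff by (simp add: var_x_def var_y_def one_pCons)
  finally have "h + 1 \<noteq> 0" .
  have "t * y \<noteq> 0" unfolding t to_fract_eq_0_iff
    by (simp add: var_x_def var_y_def one_pCons power2_eq_square)
  then have "t \<noteq> 0" by auto
  have inv: "\<tau> pinchuk_P = x" "\<tau> pinchuk_f = y"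
    using pinchuk_inverse[OF \<tau> h_def t_def] y \<open>h \<noteq> 0\<close> \<open>t \<noteq> 0\<close> \<open>h + 1 \<noteq> 0\<close>
    by (simp_all add: \<tau>_def eval_xy_var_x[OF ring_map_real_fract] eval_xy_var_y[OF ring_map_real_fract])
  have "eval_Pf G = to_fract (\<gamma> G)"
    by (rule ring_map_eqI[OF ring_map_eval_Pf ring_map_compose[OF \<gamma> ring_map_to_fract]])
      (simp_all add: eval_Pf_simps \<gamma>_def eval_xy_const[OF ring_map_const_xy]
        eval_xy_var_x[OF ring_map_const_xy] eval_xy_var_y[OF ring_map_const_xy])
  with \<open>eval_Pf G = 0\<close> have "\<gamma> G = 0" by simp
  moreover have "\<tau> (\<gamma> G) = to_fract G"
    by (rule ring_map_eqI[OF ring_map_compose[OF \<gamma> \<tau>] ring_map_to_fract])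
      (simp_all add: \<gamma>_def eval_xy_const[OF ring_map_const_xy]
        eval_xy_var_x[OF ring_map_const_xy] eval_xy_var_y[OF ring_map_const_xy] inv x_def y_def,
       simp add: \<tau>_def eval_xy_const[OF ring_map_real_fract])
  ultimately have "to_fract G = 0" by (simp add: ring_map_simps[OF \<tau>])
  then show "G = 0" by simp
next
  assume "G = 0"
  then show "eval_Pf G = 0" by (simp add: eval_Pf_simps)
qed

lemma eval_Pf_eq_iff: "eval_Pf G = eval_Pf H \<longleftrightarrow> G = H"
  using eval_Pf_eq_0_iff[of "G - H"] by (simp add: eval_Pf_simps)

text \<open>
  The quotients of polynomials in \<open>P\<close> and \<open>f\<close> form a field.  It contains \<open>h = P - f\<close> and therefore, by
  \<open>pinchuk_relations\<close>, successively \<open>t\<close>, \<open>x\<close> and \<open>y\<close>, so it is everything.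
\<close>

lemma rational_in_P_f: "\<exists>A B. coprime A B \<and> B \<noteq> 0 \<and> z = eval_Pf A / eval_Pf B"
proof -
  define S where "S = {eval_Pf A / eval_Pf B | A B. B \<noteq> 0}"
  have S: "eval_Pf A / eval_Pf B \<in> S" if "B \<noteq> 0" for A B
    using that unfolding S_def by blast
  have ev: "eval_Pf A \<in> S" for A
    using S[of 1 A] by (simp add: eval_Pf_simps)
  have add: "a + b \<in> S" and mult: "a * b \<in> S" and inv: "a \<noteq> 0 \<Longrightarrow> inverse a \<in> S"
    if ab: "a \<in> S" "b \<in> S" for a b
  proof -
    obtain A B C D where a: "a = eval_Pf A / eval_Pf B" "B \<noteq> 0" and b: "b = eval_Pf C / eval_Pf D" "D \<noteq> 0"
      using ab unfolding S_def by blast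
    have "a + b = eval_Pf (A * D + C * B) / eval_Pf (B * D)"
      using a b by (simp add: eval_Pf_simps eval_Pf_eq_0_iff add_frac_eq)
    then show "a + b \<in> S" using S[of "B * D"] a b by simp
    have "a * b = eval_Pf (A * C) / eval_Pf (B * D)" using a b by (simp add: eval_Pf_simps)
    then show "a * b \<in> S" using S[of "B * D"] a b by simp
    show "inverse a \<in> S" if "a \<noteq> 0"
      using S[of A B] a that by (cases "A = 0") (auto simp: eval_Pf_simps)
  qed
  have div: "a / b \<in> S" if "a \<in> S" "b \<in> S" "b \<noteq> 0" for a b
    using mult[OF that(1) inv[OF that(2,2,3)]] by (simp add: divide_inverse)
  have neg: "- a \<in> S" if "a \<in> S" for a
    using mult[OF ev[of "- 1"] that] by (simp add: eval_Pf_simps)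
  have diff: "a - b \<in> S" if "a \<in> S" "b \<in> S" for a b
    using add[OF that(1) neg[OF that(2)]] by simp
  define h t f where "h = to_fract pinchuk_h" and "t = to_fract pinchuk_t" and "f = to_fract pinchuk_f"
  have relations: "f * (h - t) = h^2 * (h + 1)" "to_fract var_x * t^2 = h - t"
    "to_fract var_y * (h - t) = (t + 1) * t^2"
    using pinchuk_relations[THEN arg_cong[of _ _ to_fract]]
    by (simp_all add: ring_map_simps[OF ring_map_to_fract] h_def t_def f_def)
  have h_eval: "h = eval_Pf (var_x - var_y)" by (simp add: eval_Pf_simps h_def) (simp add: pinchuk_P_def)
  have f_eval: "f = eval_Pf var_y" by (simp add: eval_Pf_simps f_def)
  have "f \<noteq> 0" unfolding f_eval eval_Pf_eq_0_iff by (simp add: var_y_def)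
  have "h \<noteq> 0" unfolding h_eval eval_Pf_eq_0_iff by (simp add: var_x_def var_y_def)
  have "h + 1 = eval_Pf (var_x - var_y + 1)" unfolding h_eval by (simp add: eval_Pf_simps)
  also have "\<dots> \<noteq> 0" unfolding eval_Pf_eq_0_iff by (simp add: var_x_def var_y_def one_pCons)
  finally have "h - t \<noteq> 0" using relations(1) \<open>h \<noteq> 0\<close> by auto
  then have "t \<noteq> 0" using relations(2) by auto
  have h: "h \<in> S" and f: "f \<in> S" unfolding h_eval f_eval by (rule ev)+
  have one: "1 \<in> S" using ev[of 1] by (simp add: eval_Pf_simps)
  have "t = h - h * h * (h + 1) / f"
    using relations(1) \<open>f \<noteq> 0\<close> by (simp add: field_simps power2_eq_square)
  then have t: "t \<in> S"
    using diff[OF h div[OF mult[OF mult[OF h h] add[OF h one]] f \<open>f \<noteq> 0\<close>]] by simp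
  have "to_fract var_x = (h - t) / (t * t)"
    using relations(2) \<open>t \<noteq> 0\<close> by (simp add: field_simps power2_eq_square)
  then have x: "to_fract var_x \<in> S"
    using div[OF diff[OF h t] mult[OF t t]] \<open>t \<noteq> 0\<close> by simp
  have "to_fract var_y = (t + 1) * (t * t) / (h - t)"
    using relations(3) \<open>h - t \<noteq> 0\<close> by (simp add: nonzero_eq_divide_eq power2_eq_square)
  then have y: "to_fract var_y \<in> S"
    using div[OF mult[OF add[OF t one] mult[OF t t]] diff[OF h t] \<open>h - t \<noteq> 0\<close>] by simp
  have poly: "to_fract G \<in> S" for G
  proof (induction G rule: real_poly_poly_induct)
    case (const c)
    show ?case using ev[of "const_xy c"] by (simp add: eval_Pf_simps)
  qed (simp_all add: x y add mult)
  obtain a b where "z = Fract a b" "b \<noteq> 0" by (cases z) auto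
  then have "z \<in> S" using div[OF poly poly, of b a] by (simp add: Fract_conv_to_fract)
  then obtain A B where z: "z = eval_Pf A / eval_Pf B" "B \<noteq> 0" unfolding S_def by blast
  define g where "g = gcd A B"
  have "g \<noteq> 0" using z by (simp add: g_def)
  then obtain A' B' where AB: "A = A' * g" "B = B' * g" "coprime A' B'"
    unfolding g_def using gcd_coprime_exists by blast
  then have "z = eval_Pf A' / eval_Pf B'"
    using \<open>g \<noteq> 0\<close> z by (simp add: eval_Pf_simps eval_Pf_eq_0_iff)
  moreover have "B' \<noteq> 0" using AB z by force
  ultimately show ?thesis using AB by blast
qed

section \<open>Rigidity\<close>

lemma eval_Pf_homogenization:
  assumes "B \<noteq> 0"
  shows "eval_Pf (homogenization F A B) =
    eval_xy real_fract (to_fract pinchuk_P) (eval_Pf A / eval_Pf B) F * eval_Pf B ^ degree F"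
proof -
  define \<phi> where "\<phi> = (\<lambda>c. poly (map_poly real_fract c) (to_fract pinchuk_P))"
  have \<phi>: "ring_map \<phi>" unfolding \<phi>_def by (rule ring_map_poly[OF ring_map_real_fract])
  have smult: "eval_Pf (smult c G) = \<phi> c * eval_Pf G" for c G
  proof -
    have "eval_Pf [:c:] = \<phi> c"
      by (simp add: eval_xy_def \<phi>_def map_poly_pCons)
    then show ?thesis using ring_map_mult[OF ring_map_eval_Pf, of "[:c:]" G] by simp
  qed
  have "eval_Pf B \<noteq> 0" using assms by (simp add: eval_Pf_eq_0_iff)
  have "eval_Pf (homogenization F A B) =
      (\<Sum>k\<le>degree F. \<phi> (coeff F k) * (eval_Pf A ^ k * eval_Pf B ^ (degree F - k)))"
    by (simp add: homogenization_def eval_Pf_simps smult)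
  also have "\<dots> = (\<Sum>k\<le>degree F. \<phi> (coeff F k) * (eval_Pf A / eval_Pf B) ^ k) * eval_Pf B ^ degree F"
    unfolding sum_distrib_right
    using \<open>eval_Pf B \<noteq> 0\<close> by (intro sum.cong refl) (simp add: power_divide power_diff)
  also have "(\<Sum>k\<le>degree F. \<phi> (coeff F k) * (eval_Pf A / eval_Pf B) ^ k) =
      eval_xy real_fract (to_fract pinchuk_P) (eval_Pf A / eval_Pf B) F"
    unfolding eval_xy_def \<phi>_def[symmetric] by (rule poly_map_poly_eq_sum[OF \<phi>, symmetric])
  finally show ?thesis .
qed

lemma ring_map_eval_xy_commute:
  assumes \<sigma>: "ring_map \<sigma>" and "\<And>c. \<sigma> (\<iota> c) = \<kappa> c" and \<iota>: "ring_map \<iota>" and \<kappa>: "ring_map \<kappa>"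
  shows "\<sigma> (eval_xy \<iota> a b G) = eval_xy \<kappa> (\<sigma> a) (\<sigma> b) G"
  by (rule ring_map_eqI[OF ring_map_compose[OF ring_map_eval_xy[OF \<iota>] \<sigma>] ring_map_eval_xy[OF \<kappa>]])
    (simp_all add: assms eval_xy_const[OF \<iota>] eval_xy_var_x[OF \<iota>] eval_xy_var_y[OF \<iota>]
      eval_xy_const[OF \<kappa>] eval_xy_var_x[OF \<kappa>] eval_xy_var_y[OF \<kappa>])

text \<open>
  Write \<open>\<sigma> f\<close> as a reduced fraction \<open>A / B\<close> in \<open>P\<close> and \<open>f\<close>.  Applying \<open>\<sigma>\<close> to \<open>F(P, f) = Q f\<^sup>2\<close> gives
  \<open>F(P, \<sigma> f) = Q (\<sigma> f)\<^sup>2\<close>.  By algebraic independence, eliminating \<open>Q\<close> between the two turns this into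
  the polynomial identity to which \<open>rational_symmetry\<close> applies.
\<close>

lemma ring_map_fixing_PQ_fixes_f:
  assumes \<sigma>: "ring_map \<sigma>" and const: "\<And>c. \<sigma> (real_fract c) = real_fract c"
    and P: "\<sigma> (to_fract pinchuk_P) = to_fract pinchuk_P"
    and Q: "\<sigma> (to_fract pinchuk_Q) = to_fract pinchuk_Q"
  shows "\<sigma> (to_fract pinchuk_f) = to_fract pinchuk_f"
proof -
  define F where "F = pinchuk_numerator"
  obtain A B where cop: "coprime A B" and B: "B \<noteq> 0" and g: "\<sigma> (to_fract pinchuk_f) = eval_Pf A / eval_Pf B"
    using rational_in_P_f by blast
  have eB: "eval_Pf B \<noteq> 0" using B by (simp add: eval_Pf_eq_0_iff)
  have deg: "degree F = 6" and lead: "coeff F 6 = [:197/4:]" and next_coeff: "coeff F 5 = [:-104, -114:]"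
    and const0: "coeff F 0 = [:0,0,0,0,-1,-2,-1:]"
    unfolding F_def pinchuk_numerator_expand by (simp_all add: eval_nat_numeral)
  have "\<sigma> (eval_Pf F) = to_fract pinchuk_Q * \<sigma> (to_fract pinchuk_f)^2"
    unfolding F_def eval_Pf_numerator by (simp add: ring_map_simps[OF \<sigma>] Q)
  moreover have "\<sigma> (eval_Pf F) = eval_xy real_fract (to_fract pinchuk_P) (\<sigma> (to_fract pinchuk_f)) F"
    using ring_map_eval_xy_commute[OF \<sigma> const ring_map_real_fract ring_map_real_fract] P by simp
  ultimately have "eval_Pf (homogenization F A B) = to_fract pinchuk_Q * (eval_Pf A / eval_Pf B)^2 * eval_Pf B ^ 6"
    unfolding eval_Pf_homogenization[OF B] g[symmetric] deg by simp
  also have "\<dots> = to_fract pinchuk_Q * (eval_Pf A ^ 2 * eval_Pf B ^ 4)"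
    using eB by (simp add: field_simps power_numeral_reduce)
  finally have hom: "eval_Pf (homogenization F A B) = to_fract pinchuk_Q * (eval_Pf A ^ 2 * eval_Pf B ^ 4)" .
  have "monom 1 2 = var_y ^ 2" by (simp add: var_y_def monom_altdef)
  then have "eval_Pf (homogenization F A B * monom 1 2) =
      eval_Pf (homogenization F A B) * to_fract pinchuk_f ^ 2"
    by (simp only: eval_Pf_simps)
  also have "\<dots> = eval_Pf F * (eval_Pf A ^ 2 * eval_Pf B ^ 4)"
    unfolding hom unfolding F_def eval_Pf_numerator by (simp only: mult_ac)
  also have "\<dots> = eval_Pf (F * A ^ 2 * B ^ (degree F - 2))"
    unfolding deg by (simp add: ring_map_mult[OF ring_map_eval_Pf] ring_map_power[OF ring_map_eval_Pf])
  finally have "eval_Pf (homogenization F A B * monom 1 2) = eval_Pf (F * A ^ 2 * B ^ (degree F - 2))" .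
  then have "homogenization F A B * monom 1 2 = F * A ^ 2 * B ^ (degree F - 2)"
    by (simp only: eval_Pf_eq_iff)
  moreover have "is_unit (lead_coeff F)"
    using lead deg by (simp add: is_unit_const_poly_iff dvd_field_iff)
  ultimately have "A = B * monom 1 1"
    using rational_symmetry[OF cop B, of 2 F] by (simp add: deg next_coeff const0)
  also have "\<dots> = B * var_y" by (simp add: var_y_def monom_altdef)
  finally show ?thesis using g eB by (simp add: eval_Pf_simps)
qed

lemma ring_map_fixing_PQ_is_identity:
  assumes \<sigma>: "ring_map \<sigma>" and const: "\<And>c. \<sigma> (real_fract c) = real_fract c"
    and P: "\<sigma> (to_fract pinchuk_P) = to_fract pinchuk_P"
    and Q: "\<sigma> (to_fract pinchuk_Q) = to_fract pinchuk_Q"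
  shows "\<sigma> z = z"
proof -
  obtain A B where B: "B \<noteq> 0" and z: "z = eval_Pf A / eval_Pf B"
    using rational_in_P_f by blast
  have "\<sigma> (eval_Pf G) = eval_Pf G" for G
    using ring_map_eval_xy_commute[OF \<sigma> const ring_map_real_fract ring_map_real_fract]
      P ring_map_fixing_PQ_fixes_f[OF assms] by simp
  moreover have "z * eval_Pf B = eval_Pf A" "eval_Pf B \<noteq> 0"
    using B z by (simp_all add: eval_Pf_eq_0_iff)
  ultimately show ?thesis
    using ring_map_mult[OF \<sigma>, of z "eval_Pf B"] by simp
qed

lemma trivial_group_sub_BijGroup:
  "trivial_group (BijGroup S \<lparr>carrier := {\<lambda>x\<in>S. x}\<rparr>)"
proof -
  interpret group "BijGroup S" by (rule group_BijGroup)
  have "group (BijGroup S \<lparr>carrier := {\<one>\<^bsub>BijGroup S\<^esub>}\<rparr>)"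
    using triv_subgroup by (rule subgroup.subgroup_is_group) (rule is_group)
  then show ?thesis by (simp add: trivial_group_def BijGroup_def)
qed

theorem proposition9:
  shows "trivial_group (field_ext_aut_group field_R_xy (adjoin_R {pinchuk_P, pinchuk_Q}))"
proof -
  have carrier: "carrier field_R_xy = UNIV" by (simp add: ring_of_type_algebra_def)
  let ?K = "adjoin_R {pinchuk_P, pinchuk_Q}"
  have fixed: "to_fract G \<in> ?K" if "G \<in> range const_xy \<union> {pinchuk_P, pinchuk_Q}" for G
    unfolding adjoin_R_def using that by (intro generate_field.incl imageI)
  have "{\<sigma> \<in> ring_iso field_R_xy field_R_xy \<inter> Bij (carrier field_R_xy). \<forall>a\<in>?K. \<sigma> a = a} = {\<lambda>x\<in>UNIV. x}"
    (is "?Aut = _")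
  proof (intro equalityI subsetI)
    fix \<sigma> assume "\<sigma> \<in> ?Aut"
    then have hom: "\<sigma> \<in> ring_hom field_R_xy field_R_xy" and fixes_K: "\<And>a. a \<in> ?K \<Longrightarrow> \<sigma> a = a"
      by (auto simp: ring_iso_def)
    have "ring_map \<sigma>"
      using ring_hom_one[OF hom] ring_hom_add[OF hom] ring_hom_mult[OF hom]
      by (intro ring_mapI) (simp_all add: ring_of_type_algebra_def)
    then have "\<sigma> z = z" for z
      by (rule ring_map_fixing_PQ_is_identity) (auto intro!: fixes_K fixed)
    then show "\<sigma> \<in> {\<lambda>x\<in>UNIV. x}" by auto
  next
    fix \<sigma> :: "real poly poly fract \<Rightarrow> real poly poly fract" assume "\<sigma> \<in> {\<lambda>x\<in>UNIV. x}"
    then show "\<sigma> \<in> ?Aut"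
      by (auto simp: ring_iso_def ring_hom_def carrier Bij_def bij_betw_def)
  qed
  then show ?thesis
    unfolding field_ext_aut_group_def
    using trivial_group_sub_BijGroup by (simp only: carrier)
qed

end
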